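(* Let $(S,\|\cdot\|)$ be a commutative unital Banach ring with multiplicative norm. The following statements are equivalent: (S1) $\mathbb{A}_S^1$ is second countable. (S2) $S$ is separable as a metric space. (S3) $\mathcal{M}(S\{n^{-1}\mathbf{t}\})$, identified with the subspace $\{\mu\in\mathbb{A}_S^1:|\mathbf{t}|_\mu\le n\}$ of $\mathbb{A}_S^1$, is metrizable for every $n\in\mathbb{N}$ (positive integers).
   Context: For a commutative unital Banach ring $(S,\|\cdot\|)$, the Berkovich spectrum $\mathcal{M}(S)$ is the set of all non-zero contractive multiplicative seminorms on $S$, and $\mathbb{A}_S^1$ is the set of all non-zero multiplicative seminorms $\mu$, written $\mathbf{p}\mapsto|\mathbf{p}|_\mu$, on the polynomial ring $S[\mathbf{t}]$ whose restrictions to $S$ are contractive ($|a|_\mu\le\|a\|$ for $a\in S$); both carry the topology of pointwise convergence. For $n\in\mathbb{N}$, $S\{n^{-1}\mathbf{t}\}:=\{\sum_{k=0}^\infty a_k\mathbf{t}^k:\lim_k\|a_k\|n^k=0\}$ with norm $\|\sum_k a_k\mathbf{t}^k\|:=\max_k\|a_k\|n^k$. The paper uses throughout the identification (by restriction of seminorms to $S[\mathbf{t}]$) of the compact space $\mathcal{M}(S\{n^{-1}\mathbf{t}\})$ with the subspace $\{\mu\in\mathbb{A}_S^1:|\mathbf{t}|_\mu\le n\}$ of $\mathbb{A}_S^1$; (S3) is to be understood as a statement about this subspace. *)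

theory Defs
  imports "HOL-Analysis.Analysis" "HOL-Computational_Algebra.Polynomial"
begin

text \<open>
  The norm is an explicit parameter rather than the overloaded \<^const>\<open>norm\<close>, which is only
  available on real vector spaces; this would exclude for instance the \<open>p\<close>-adic integers.
\<close>

definition norm_dist :: "('a::comm_ring_1 \<Rightarrow> real) \<Rightarrow> 'a \<Rightarrow> 'a \<Rightarrow> real" where
  "norm_dist N a b = N (a - b)"

definition comm_banach_ring :: "('a::comm_ring_1 \<Rightarrow> real) \<Rightarrow> bool" where
  "comm_banach_ring N \<longleftrightarrow>
     (\<forall>a. 0 \<le> N a) \<and> (\<forall>a. N a = 0 \<longleftrightarrow> a = 0) \<and>
     (\<forall>a b. N (a - b) \<le> N a + N b) \<and>
     (\<forall>a b. N (a * b) \<le> N a * N b) \<and>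
     Metric_space.mcomplete UNIV (norm_dist N)"

text \<open>
  The triangle inequality is the ordinary one. If the norm of the base ring is ultrametric,
  the elements of \<open>affine_line\<close> below satisfy \<open>\<mu> (p + q) \<le> max (\<mu> p) (\<mu> q)\<close> automatically, since
  they are multiplicative and bounded by \<open>1\<close> on the image of the integers.
\<close>

definition multiplicative_seminorm :: "('a::comm_ring_1 \<Rightarrow> real) \<Rightarrow> bool" where
  "multiplicative_seminorm \<mu> \<longleftrightarrow>
     (\<forall>p. 0 \<le> \<mu> p) \<and> \<mu> 0 = 0 \<and>
     (\<forall>p q. \<mu> (p - q) \<le> \<mu> p + \<mu> q) \<and>
     (\<forall>p q. \<mu> (p * q) = \<mu> p * \<mu> q)"

definition affine_line :: "('a::comm_ring_1 \<Rightarrow> real) \<Rightarrow> ('a poly \<Rightarrow> real) set" where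
  "affine_line N = {\<mu>. multiplicative_seminorm \<mu> \<and> (\<exists>p. \<mu> p \<noteq> 0) \<and> (\<forall>a. \<mu> [:a:] \<le> N a)}"

definition affine_line_topology :: "('a::comm_ring_1 \<Rightarrow> real) \<Rightarrow> ('a poly \<Rightarrow> real) topology" where
  "affine_line_topology N = subtopology (powertop_real UNIV) (affine_line N)"

text \<open>
  The Berkovich spectrum of \<open>S{n\<^sup>-\<^sup>1 t}\<close>, identified by restriction of seminorms to polynomials
  with the closed disc of radius \<open>n\<close> in the affine line; \<open>[:0, 1:]\<close> is the variable \<open>t\<close>.
\<close>

definition spectrum_disc_topology ::
    "('a::comm_ring_1 \<Rightarrow> real) \<Rightarrow> nat \<Rightarrow> ('a poly \<Rightarrow> real) topology" where
  "spectrum_disc_topology N n =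
     subtopology (affine_line_topology N) {\<mu> \<in> affine_line N. \<mu> [:0, 1:] \<le> real n}"

end

theory Submission
  imports Defs
begin

text \<open>
  Everything rests on comparing the affine line with two simpler spaces.

  In one direction, a point \<open>a\<close> of the ring gives the seminorm \<open>p \<mapsto> N (p(a))\<close>, and
  multiplicativity of \<open>N\<close> is exactly what places it in the affine line. Its value at \<open>t - c\<close> is
  \<open>N (a - c)\<close>, so the topology that the ring inherits in this way is at least as fine as the one
  defined by \<open>N\<close>: a subset of the point evaluations that is dense among them comes from a
  dense subset of the ring (\<open>dense_point_evaluations_imp_dense_points\<close>). If the affine line is
  second countable, all of its subspaces are separable, hence so is the ring. If only the discs
  are known to be metrizable, compactness (\<open>compact_space_spectrum_disc\<close>) makes them totally
  bounded, a property that passes to arbitrary subsets; so each ball \<open>N a \<le> n\<close> contains a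
  countable dense set, and countably many of these balls cover the ring.

  In the other direction, let \<open>D\<close> be a countable dense subset of the ring. The polynomials with
  coefficients in \<open>D\<close> are countable in number, and every polynomial \<open>p\<close> is approximated by one of
  them, \<open>q\<close> say, uniformly over a disc: \<open>\<bar>\<mu> p - \<mu> q\<bar> \<le> \<mu> (p - q) < e\<close> whenever \<open>\<mu> t \<le> R\<close>
  (\<open>uniform_approximation_on_disc\<close>). Hence evaluation at these countably many polynomials already
  determines the points and the topology of the affine line, which is therefore homeomorphic to a
  subspace of a countable power of the reals (\<open>affine_line_embeds_into_countable_power\<close>).
  Such a subspace is second countable and metrizable, and both properties are inherited by
  subspaces, in particular the discs.
\<close>

section \<open>Estimates for seminorms on the affine line\<close>

lemma comm_banach_ring_Metric_space:
  assumes "comm_banach_ring N"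
  shows "Metric_space UNIV (norm_dist N)"
proof -
  have N: "\<And>a. 0 \<le> N a" "\<And>a. N a = 0 \<longleftrightarrow> a = 0" "\<And>a b. N (a - b) \<le> N a + N b"
    using assms by (auto simp: comm_banach_ring_def)
  have minus: "N (- a) \<le> N a" for a
    using N(3)[of 0 a] N(2)[of 0] by simp
  have sym: "N (a - b) = N (b - a)" for a b
    using minus[of "a - b"] minus[of "b - a"] by simp
  show ?thesis
  proof
    fix x y z :: 'a
    have "N (x - z) \<le> N (x - y) + N (z - y)"
      using N(3)[of "x - y" "z - y"] by simp
    then show "norm_dist N x z \<le> norm_dist N x y + norm_dist N y z"
      by (simp add: norm_dist_def sym[of z y])
  qed (auto simp: norm_dist_def N sym)
qed

lemma multiplicative_seminorm_minus:
  assumes "multiplicative_seminorm \<mu>"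
  shows "\<mu> (- p) = \<mu> p"
proof -
  have "\<mu> (- q) \<le> \<mu> q" for q
    using assms unfolding multiplicative_seminorm_def by (metis add_0 diff_0)
  from this[of p] this[of "- p"] show ?thesis by simp
qed

lemma multiplicative_seminorm_add:
  assumes "multiplicative_seminorm \<mu>"
  shows "\<mu> (p + q) \<le> \<mu> p + \<mu> q"
  using assms multiplicative_seminorm_minus[OF assms, of q]
  unfolding multiplicative_seminorm_def by (metis diff_minus_eq_add)

lemma multiplicative_seminorm_abs_diff:
  assumes "multiplicative_seminorm \<mu>"
  shows "\<bar>\<mu> p - \<mu> q\<bar> \<le> \<mu> (p - q)"
proof -
  have "\<mu> p \<le> \<mu> (p - q) + \<mu> q"
    using multiplicative_seminorm_add[OF assms, of "p - q" q] by simp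
  moreover have "\<mu> q \<le> \<mu> (q - p) + \<mu> p"
    using multiplicative_seminorm_add[OF assms, of "q - p" p] by simp
  moreover have "\<mu> (q - p) = \<mu> (p - q)"
    using multiplicative_seminorm_minus[OF assms, of "p - q"] by simp
  ultimately show ?thesis by linarith
qed

lemma affine_line_seminorm: "\<mu> \<in> affine_line N \<Longrightarrow> multiplicative_seminorm \<mu>"
  by (simp add: affine_line_def)

lemma affine_line_nonneg: "\<mu> \<in> affine_line N \<Longrightarrow> 0 \<le> \<mu> p"
  by (simp add: affine_line_def multiplicative_seminorm_def)

text \<open>
  Being non-zero is an open condition on its face; in this form it is visibly a closed one, which
  is what compactness of the discs requires.
\<close>

lemma multiplicative_seminorm_nonzero_iff:
  assumes "multiplicative_seminorm \<mu>"
  shows "(\<exists>p. \<mu> p \<noteq> 0) \<longleftrightarrow> \<mu> 1 = 1"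
  using assms unfolding multiplicative_seminorm_def
  by (metis mult_1 mult_cancel_right1 zero_neq_one)

text \<open>
  Writing a polynomial as \<open>a + t p\<close> gives the Horner step by which both uniform estimates below
  go by induction along the coefficients.
\<close>

lemma affine_line_pCons_le:
  assumes \<mu>: "\<mu> \<in> affine_line N" and R: "\<mu> [:0, 1:] \<le> R"
  shows "\<mu> (pCons a p) \<le> N a + R * \<mu> p"
proof -
  have "\<mu> (pCons a p) = \<mu> ([:a:] + [:0, 1:] * p)"
    by simp
  also have "\<dots> \<le> \<mu> [:a:] + \<mu> ([:0, 1:] * p)"
    by (intro multiplicative_seminorm_add affine_line_seminorm[OF \<mu>])
  also have "\<mu> ([:0, 1:] * p) = \<mu> [:0, 1:] * \<mu> p"
    using \<mu> by (auto simp only: affine_line_def multiplicative_seminorm_def)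
  also have "\<mu> [:a:] + \<mu> [:0, 1:] * \<mu> p \<le> N a + R * \<mu> p"
    using \<mu> R by (intro add_mono mult_right_mono affine_line_nonneg[OF \<mu>])
      (auto simp: affine_line_def)
  finally show ?thesis .
qed

text \<open>
  The bound depends on \<open>p\<close> and \<open>R\<close> alone, so a disc lies in a product of compact intervals.
\<close>

lemma affine_line_bounded_on_disc:
  assumes "0 \<le> R"
  shows "\<exists>B. \<forall>\<mu>\<in>affine_line N. \<mu> [:0, 1:] \<le> R \<longrightarrow> \<mu> p \<le> B"
proof (induction p)
  case 0
  then show ?case
    by (intro exI[of _ 0]) (simp add: affine_line_def multiplicative_seminorm_def)
next
  case (pCons a p)
  then obtain B where B: "\<And>\<mu>. \<mu> \<in> affine_line N \<Longrightarrow> \<mu> [:0, 1:] \<le> R \<Longrightarrow> \<mu> p \<le> B"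
    by blast
  have "\<mu> (pCons a p) \<le> N a + R * B" if "\<mu> \<in> affine_line N" "\<mu> [:0, 1:] \<le> R" for \<mu>
    using affine_line_pCons_le[OF that, of a p] mult_left_mono[OF B[OF that] assms] by linarith
  then show ?case by blast
qed

text \<open>
  Replacing the coefficients of \<open>p\<close> by nearby elements of \<open>D\<close> moves \<open>\<mu> p\<close> by at most
  \<open>\<Sum>i. N (a\<^sub>i - d\<^sub>i) * R ^ i\<close>, the same amount for all \<open>\<mu>\<close> in the disc.
\<close>

lemma uniform_approximation_on_disc:
  assumes D: "\<And>a e. 0 < e \<Longrightarrow> \<exists>d\<in>D. N (a - d) < e" and "0 \<le> R" and "0 < e"
  shows "\<exists>q\<in>Poly ` lists D. \<forall>\<mu>\<in>affine_line N. \<mu> [:0, 1:] \<le> R \<longrightarrow> \<mu> (p - q) < e"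
  using \<open>0 < e\<close>
proof (induction p arbitrary: e)
  case 0
  then show ?case
    by (intro bexI[of _ 0] image_eqI[of _ _ "[]"])
      (simp_all add: affine_line_def multiplicative_seminorm_def)
next
  case (pCons a p)
  have half: "c * (e / (2 * c)) = e / 2" if "c \<noteq> 0" for c :: real
    using that by simp
  \<comment> \<open>Dividing by \<open>R + 1\<close> instead of \<open>R\<close> covers the disc of radius \<open>0\<close> as well.\<close>
  have pos: "0 < e / (2 * (R + 1))"
    using pCons.prems \<open>0 \<le> R\<close> by simp
  obtain xs where xs: "xs \<in> lists D"
    and q: "\<And>\<mu>. \<mu> \<in> affine_line N \<Longrightarrow> \<mu> [:0, 1:] \<le> R \<Longrightarrow> \<mu> (p - Poly xs) < e / (2 * (R + 1))"
    using pCons.IH[OF pos] by blast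
  obtain d where d: "d \<in> D" "N (a - d) < e / 2"
    using D[of "e / 2" a] pCons.prems by auto
  have "\<mu> (pCons a p - Poly (d # xs)) < e"
    if \<mu>: "\<mu> \<in> affine_line N" "\<mu> [:0, 1:] \<le> R" for \<mu>
  proof -
    have "\<mu> (pCons a p - Poly (d # xs)) = \<mu> (pCons (a - d) (p - Poly xs))"
      by simp
    also have "\<dots> \<le> N (a - d) + R * \<mu> (p - Poly xs)"
      by (rule affine_line_pCons_le[OF \<mu>])
    also have "R * \<mu> (p - Poly xs) \<le> (R + 1) * (e / (2 * (R + 1)))"
      using q[OF \<mu>] \<open>0 \<le> R\<close> affine_line_nonneg[OF \<mu>(1)] by (intro mult_mono) auto
    also have "\<dots> = e / 2"
      using \<open>0 \<le> R\<close> by (intro half) simp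
    finally show ?thesis using d(2) by linarith
  qed
  moreover have "Poly (d # xs) \<in> Poly ` lists D"
    using d(1) xs by (intro imageI) simp
  ultimately show ?case
    by (intro bexI[of _ "Poly (d # xs)"] ballI impI)
qed

section \<open>Separable base rings: embedding the affine line into a countable power of the reals\<close>

lemma topspace_affine_line_topology [simp]: "topspace (affine_line_topology N) = affine_line N"
  by (simp add: affine_line_topology_def)

lemma continuous_map_affine_line_evaluation:
  "continuous_map (affine_line_topology N) euclideanreal (\<lambda>\<mu>. \<mu> p)"
  unfolding affine_line_topology_def by (intro continuous_intros) simp

lemma second_countable_euclidean:
  "second_countable (euclidean :: 'b::second_countable_topology topology)"
proof -
  obtain B :: "'b set set" where "countable B" "topological_basis B"
    using ex_countable_basis by blast
  then show ?thesis
    unfolding second_countable_def topological_basis_def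
    by (metis open_openin topological_basisE \<open>topological_basis B\<close>)
qed

text \<open>
  The embedding lists \<open>\<mu> t\<close> and the values at polynomials with coefficients in \<open>D\<close>. A value
  \<open>\<mu> p\<close> is a limit of such values that is uniform on every disc, but in general not on the whole line; the
  inverse is continuous because each point has a neighbourhood inside a disc.
\<close>

lemma affine_line_embeds_into_countable_power:
  assumes D: "\<And>a e. 0 < e \<Longrightarrow> \<exists>d\<in>D. N (a - d) < e" and "countable D"
  shows "\<exists>T. affine_line_topology N homeomorphic_space
           subtopology (euclidean :: (nat \<Rightarrow> real) topology) T"
proof -
  define A where "A = affine_line N"
  \<comment> \<open>The variable is included so that \<open>\<mu> t < R\<close> is an open condition on the coordinates of \<open>\<mu>\<close>.\<close>
  define Q where "Q = insert [:0, 1:] (Poly ` lists D)"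
  have "countable Q" "Q \<noteq> {}"
    using \<open>countable D\<close> by (auto simp: Q_def)
  then have range: "range (from_nat_into Q) = Q"
    by (simp add: range_from_nat_into)
  define F :: "('a poly \<Rightarrow> real) \<Rightarrow> nat \<Rightarrow> real" where "F \<mu> i = \<mu> (from_nat_into Q i)" for \<mu> i
  obtain i0 where i0: "from_nat_into Q i0 = [:0, 1:]"
    using range by (metis Q_def insertI1 rangeE)
  have index: "\<exists>i. from_nat_into Q i = q" if "q \<in> Poly ` lists D" for q
    using that range by (metis Q_def insertI2 rangeE)
  define Y where "Y = subtopology (euclidean :: (nat \<Rightarrow> real) topology) (F ` A)"
  have approx: "\<exists>i. \<forall>\<mu>\<in>A. \<mu> [:0, 1:] \<le> R \<longrightarrow> \<bar>\<mu> p - F \<mu> i\<bar> < e" if Re: "0 \<le> R" "0 < e" for p R e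
  proof -
    obtain q where q: "q \<in> Poly ` lists D" "\<forall>\<mu>\<in>A. \<mu> [:0, 1:] \<le> R \<longrightarrow> \<mu> (p - q) < e"
      using uniform_approximation_on_disc[of D N R e p, OF D Re] unfolding A_def by blast
    obtain i where "from_nat_into Q i = q"
      using index[OF q(1)] ..
    then have "\<bar>\<mu> p - F \<mu> i\<bar> < e" if "\<mu> \<in> A" "\<mu> [:0, 1:] \<le> R" for \<mu>
      using that q(2) multiplicative_seminorm_abs_diff[of \<mu> p q]
      by (force simp: F_def A_def dest: affine_line_seminorm)
    then show ?thesis by blast
  qed
  have inj: "inj_on F A"
  proof (rule inj_onI, rule ext, rule ccontr)
    fix \<mu> \<nu> p assume *: "\<mu> \<in> A" "\<nu> \<in> A" "F \<mu> = F \<nu>" "\<mu> p \<noteq> \<nu> p"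
    define R where "R = max (\<mu> [:0, 1:]) (\<nu> [:0, 1:])"
    define e where "e = \<bar>\<mu> p - \<nu> p\<bar> / 2"
    have "0 \<le> R" "0 < e"
      using * affine_line_nonneg[of \<mu> N] affine_line_nonneg[of \<nu> N] by (auto simp: R_def e_def A_def max_def)
    then obtain i where "\<forall>\<mu>\<in>A. \<mu> [:0, 1:] \<le> R \<longrightarrow> \<bar>\<mu> p - F \<mu> i\<bar> < e"
      using approx by blast
    then have "\<bar>\<mu> p - F \<mu> i\<bar> < e" "\<bar>\<nu> p - F \<nu> i\<bar> < e"
      using * by (auto simp: R_def)
    moreover have "F \<mu> i = F \<nu> i" using * by simp
    moreover have "\<bar>\<mu> p - \<nu> p\<bar> \<le> \<bar>\<mu> p - F \<mu> i\<bar> + \<bar>\<nu> p - F \<mu> i\<bar>"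
      using abs_triangle_ineq4[of "\<mu> p - F \<mu> i" "\<nu> p - F \<mu> i"] by simp
    ultimately show False unfolding e_def by simp
  qed
  have coord: "continuous_map Y euclideanreal (\<lambda>x. x i)" for i
    unfolding Y_def
    by (intro continuous_map_from_subtopology) (simp add: continuous_on_product_coordinates)
  have contF: "continuous_map (affine_line_topology N) Y F"
    unfolding Y_def continuous_map_in_subtopology
    by (auto simp: A_def F_def continuous_map_componentwise_UNIV continuous_map_affine_line_evaluation
        simp flip: euclidean_product_topology)
  have contG: "continuous_map Y (affine_line_topology N) (inv_into A F)"
    unfolding affine_line_topology_def continuous_map_in_subtopology continuous_map_componentwise_UNIV
  proof (intro conjI allI)
    show "inv_into A F \<in> topspace Y \<rightarrow> affine_line N"
      using inv_into_into[of _ F A] by (auto simp: Y_def A_def)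
    fix p
    have "\<exists>U. openin Y U \<and> x \<in> U \<and> (\<forall>y\<in>U. dist (inv_into A F x p) (inv_into A F y p) < e)"
      if "x \<in> topspace Y" "0 < e" for x e
    proof -
      obtain \<mu> where \<mu>: "\<mu> \<in> A" "x = F \<mu>"
        using \<open>x \<in> topspace Y\<close> by (auto simp: Y_def)
      \<comment> \<open>The margin \<open>1\<close> makes the disc of radius \<open>R\<close> a neighbourhood of \<open>\<mu>\<close>.\<close>
      define R where "R = \<mu> [:0, 1:] + 1"
      have "0 \<le> R" using \<mu>(1) affine_line_nonneg[of \<mu> N "[:0, 1:]"] by (simp add: R_def A_def)
      then obtain i where i: "\<forall>\<mu>\<in>A. \<mu> [:0, 1:] \<le> R \<longrightarrow> \<bar>\<mu> p - F \<mu> i\<bar> < e / 3"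
        using approx[of R "e / 3"] \<open>0 < e\<close> by auto
      define U where "U = {y \<in> topspace Y. y i0 \<in> {..<R}} \<inter> {y \<in> topspace Y. y i \<in> {x i - e / 3 <..< x i + e / 3}}"
      have "openin Y U"
        unfolding U_def by (intro openin_Int openin_continuous_map_preimage[OF coord]) auto
      moreover have "x \<in> U"
        using that \<mu> by (auto simp: U_def R_def F_def i0)
      moreover have "dist (inv_into A F x p) (inv_into A F y p) < e" if "y \<in> U" for y
      proof -
        obtain \<nu> where \<nu>: "\<nu> \<in> A" "y = F \<nu>"
          using \<open>y \<in> U\<close> by (auto simp: Y_def U_def)
        have "\<bar>\<nu> p - F \<nu> i\<bar> < e / 3" "\<bar>\<mu> p - F \<mu> i\<bar> < e / 3"
          using i \<mu> \<nu> \<open>y \<in> U\<close> by (auto simp: U_def R_def F_def i0)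
        moreover have "\<bar>F \<mu> i - F \<nu> i\<bar> < e / 3"
          using \<open>y \<in> U\<close> unfolding \<mu>(2) \<nu>(2) U_def abs_less_iff by simp
        ultimately have "\<bar>\<mu> p - \<nu> p\<bar> < e"
          unfolding abs_less_iff by linarith
        then show ?thesis
          using inv_into_f_f[OF inj] \<mu> \<nu> by (simp add: dist_real_def)
      qed
      ultimately show ?thesis by blast
    qed
    then show "continuous_map Y euclideanreal (\<lambda>x. inv_into A F x p)"
      using Met_TC.continuous_map_to_metric[of Y "\<lambda>x. inv_into A F x p"]
      by (simp add: Met_TC.in_mball)
  qed
  have "homeomorphic_maps (affine_line_topology N) Y F (inv_into A F)"
    unfolding homeomorphic_maps_def using contF contG inj
    by (auto simp: A_def Y_def f_inv_into_f)
  then show ?thesis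
    unfolding Y_def by (blast dest: homeomorphic_maps_imp_homeomorphic_space)
qed

section \<open>Compactness of the closed discs\<close>

text \<open>
  Each condition that defines a disc is an equation or non-strict inequality between finitely many
  values of \<open>\<mu>\<close>, hence closed for pointwise convergence; Tychonoff's theorem applies to the
  product of intervals that contains the disc.
\<close>

lemma compact_space_spectrum_disc: "compact_space (spectrum_disc_topology N n)"
proof -
  define P :: "('a poly \<Rightarrow> real) topology" where "P = powertop_real UNIV"
  define E where "E = {\<mu> \<in> affine_line N. \<mu> [:0, 1:] \<le> real n}"
  obtain B where B: "\<And>p \<mu>. \<mu> \<in> affine_line N \<Longrightarrow> \<mu> [:0, 1:] \<le> real n \<Longrightarrow> \<mu> p \<le> B p"
    using affine_line_bounded_on_disc[of "real n" N] by (metis of_nat_0_le_iff)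
  have eval: "continuous_map P euclideanreal (\<lambda>\<mu>. \<mu> p)" for p
    unfolding P_def by (intro continuous_intros) simp
  have ge: "closedin P {\<mu>. f \<mu> \<le> g \<mu>}"
    if "continuous_map P euclideanreal f" "continuous_map P euclideanreal g" for f g
  proof -
    have "closedin P {\<mu> \<in> topspace P. g \<mu> - f \<mu> \<in> {0..}}"
      by (rule closedin_continuous_map_preimage) (auto intro!: continuous_intros that)
    then show ?thesis by (simp add: P_def)
  qed
  have eq: "closedin P {\<mu>. f \<mu> = g \<mu>}"
    if "continuous_map P euclideanreal f" "continuous_map P euclideanreal g" for f g
    using closedin_Int[OF ge[OF that] ge[OF that(2,1)]] by (simp add: Int_def order_eq_iff)
  have inter: "closedin P {\<mu>. \<forall>x. \<mu> \<in> K x}" if "\<And>x. closedin P (K x)" for K :: "'c \<Rightarrow> _"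
  proof -
    have "{\<mu>. \<forall>x. \<mu> \<in> K x} = (\<Inter>x. K x)" by auto
    then show ?thesis using that by (auto intro!: closedin_INT)
  qed
  \<comment> \<open>Each quantifier is written as a membership so that the rule \<open>inter\<close> unifies with it.\<close>
  have E_eq: "E = {\<mu>. \<forall>p. \<mu> \<in> {\<mu>. 0 \<le> \<mu> p}} \<inter> {\<mu>. \<mu> 0 = 0}
      \<inter> {\<mu>. \<forall>p. \<mu> \<in> {\<mu>. \<forall>q. \<mu> \<in> {\<mu>. \<mu> (p - q) \<le> \<mu> p + \<mu> q}}}
      \<inter> {\<mu>. \<forall>p. \<mu> \<in> {\<mu>. \<forall>q. \<mu> \<in> {\<mu>. \<mu> (p * q) = \<mu> p * \<mu> q}}}
      \<inter> {\<mu>. \<mu> 1 = 1} \<inter> {\<mu>. \<forall>a. \<mu> \<in> {\<mu>. \<mu> [:a:] \<le> N a}} \<inter> {\<mu>. \<mu> [:0, 1:] \<le> real n}"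
    unfolding E_def affine_line_def
    using multiplicative_seminorm_nonzero_iff by (auto simp: multiplicative_seminorm_def)
  have "closedin P E"
    unfolding E_eq by (intro closedin_Int inter ge eq continuous_intros eval) auto
  moreover have EB: "E \<subseteq> (\<Pi>\<^sub>E p\<in>UNIV. {0..B p})"
    using B affine_line_nonneg by (auto simp: E_def)
  moreover have "compactin P (\<Pi>\<^sub>E p\<in>UNIV. {0..B p})"
    unfolding P_def by (simp add: compactin_PiE)
  ultimately have "compactin P E"
    by (intro closed_compactin[OF _ EB])
  moreover have "spectrum_disc_topology N n = subtopology P E"
    unfolding spectrum_disc_topology_def affine_line_topology_def P_def E_def
    by (simp add: subtopology_subtopology Int_absorb1 subset_iff)
  ultimately show ?thesis
    by (simp add: compact_space_subtopology)
qed

section \<open>Point evaluations and separability of the base ring\<close>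

definition point_evaluation :: "('a::comm_ring_1 \<Rightarrow> real) \<Rightarrow> 'a \<Rightarrow> 'a poly \<Rightarrow> real" where
  "point_evaluation N a p = N (poly p a)"

lemma point_evaluation_in_affine_line:
  assumes "comm_banach_ring N" and "\<And>a b. N (a * b) = N a * N b"
  shows "point_evaluation N a \<in> affine_line N"
proof -
  have "point_evaluation N a 1 \<noteq> 0"
    using assms(1) by (simp add: point_evaluation_def comm_banach_ring_def)
  then have "\<exists>p. point_evaluation N a p \<noteq> 0" by blast
  then show ?thesis
    using assms unfolding affine_line_def multiplicative_seminorm_def
    by (auto simp: point_evaluation_def comm_banach_ring_def)
qed

text \<open>
  The set \<open>{\<mu>. \<mu> (t - a) < e}\<close> is open in the affine line, and a point evaluation lies in it
  exactly when its point is at distance less than \<open>e\<close> from \<open>a\<close>.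
\<close>

lemma dense_point_evaluations_imp_dense_points:
  assumes N: "comm_banach_ring N" "\<And>a b. N (a * b) = N a * N b"
    and "countable C" "C \<subseteq> point_evaluation N ` B"
    and dense: "point_evaluation N ` B \<subseteq> affine_line_topology N closure_of C"
  shows "\<exists>D. countable D \<and> (\<forall>a\<in>B. \<forall>e>0. \<exists>d\<in>D. N (a - d) < e)"
proof -
  obtain D where D: "countable D" "C = point_evaluation N ` D"
    using assms(3,4) by (meson countable_subset_image)
  have "\<exists>d\<in>D. N (a - d) < e" if "a \<in> B" "0 < e" for a e
  proof -
    define U where "U = {\<mu> \<in> topspace (affine_line_topology N). \<mu> [:- a, 1:] \<in> {..<e}}"
    have "N 0 = 0"
      using N(1) by (simp add: comm_banach_ring_def)
    have "openin (affine_line_topology N) U"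
      unfolding U_def
      by (rule openin_continuous_map_preimage[OF continuous_map_affine_line_evaluation]) auto
    moreover have "point_evaluation N a \<in> U"
      using point_evaluation_in_affine_line[of N a, OF N] \<open>N 0 = 0\<close> \<open>0 < e\<close>
      by (simp add: U_def) (simp add: point_evaluation_def)
    moreover have "point_evaluation N a \<in> affine_line_topology N closure_of C"
      using dense \<open>a \<in> B\<close> by blast
    ultimately have "\<exists>\<mu>. \<mu> \<in> C \<and> \<mu> \<in> U"
      unfolding in_closure_of by blast
    then obtain d where "d \<in> D" "point_evaluation N d \<in> U"
      unfolding D(2) by blast
    then have "d \<in> D" "N (d - a) < e"
      by (auto simp: U_def point_evaluation_def)
    moreover have "N (d - a) = N (a - d)"
      using Metric_space.commute[OF comm_banach_ring_Metric_space[OF N(1)], of d a]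
      by (simp add: norm_dist_def)
    ultimately show ?thesis by auto
  qed
  with D(1) show ?thesis by blast
qed

text \<open>
  Separability alone does not pass to subspaces. The next two lemmas obtain it for an arbitrary
  subset from properties that do: second countability and total boundedness.
\<close>

lemma second_countable_imp_countable_dense_subset:
  assumes "second_countable X" "E \<subseteq> topspace X"
  shows "\<exists>C. countable C \<and> C \<subseteq> E \<and> E \<subseteq> X closure_of C"
proof -
  have "separable_space (subtopology X E)"
    by (intro second_countable_imp_separable_space second_countable_subtopology assms)
  then show ?thesis
    using assms(2) unfolding separable_space_def
    by (auto simp: closure_of_subtopology Int_absorb1)
qed

lemma compact_metrizable_imp_countable_dense_subset:
  assumes "compact_space X" "metrizable_space X" "E \<subseteq> topspace X"
  shows "\<exists>C. countable C \<and> C \<subseteq> E \<and> E \<subseteq> X closure_of C"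
proof -
  obtain M d where "Metric_space M d" and X: "X = Metric_space.mtopology M d"
    using assms(2) by (auto simp: metrizable_space_def)
  then interpret Metric_space M d by simp
  have "mtotally_bounded M"
    using assms(1) compactin_imp_mtotally_bounded by (simp add: X compact_space_def)
  then have tb: "mtotally_bounded E"
    using assms(3) by (auto simp: X intro: mtotally_bounded_subset)
  have "\<forall>k::nat. \<exists>K. finite K \<and> K \<subseteq> E \<and> E \<subseteq> (\<Union>x\<in>K. mball x (inverse (Suc k)))"
    using tb unfolding mtotally_bounded_def by (auto simp del: of_nat_Suc)
  then obtain K where K: "\<And>k::nat. finite (K k)" "\<And>k. K k \<subseteq> E"
      "\<And>k. E \<subseteq> (\<Union>x\<in>K k. mball x (inverse (Suc k)))"
    by metis
  have "E \<subseteq> mtopology closure_of (\<Union>k. K k)"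
  proof
    fix x assume "x \<in> E"
    have "\<exists>y\<in>\<Union>k. K k. y \<in> mball x r" if "0 < r" for r
    proof -
      obtain k where k: "inverse (real (Suc k)) < r"
        using reals_Archimedean[OF \<open>0 < r\<close>] by blast
      obtain y where "y \<in> K k" "x \<in> mball y (inverse (Suc k))"
        using K(3) \<open>x \<in> E\<close> by blast
      then show ?thesis
        using k by (intro bexI[of _ y]) (auto simp: commute simp del: of_nat_Suc)
    qed
    then show "x \<in> mtopology closure_of (\<Union>k. K k)"
      using \<open>x \<in> E\<close> assms(3) by (auto simp: metric_closure_of X)
  qed
  moreover have "countable (\<Union>k. K k)"
    using K(1) by (simp add: countable_finite)
  ultimately show ?thesis
    using K(2) X by blast
qed

lemma separable_norm_iff:
  assumes "comm_banach_ring N"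
  shows "separable_space (Metric_space.mtopology UNIV (norm_dist N)) \<longleftrightarrow>
    (\<exists>D. countable D \<and> (\<forall>a. \<forall>e>0. \<exists>d\<in>D. N (a - d) < e))"
proof -
  interpret Metric_space UNIV "norm_dist N"
    by (rule comm_banach_ring_Metric_space[OF assms])
  show ?thesis
    unfolding separable_space_def metric_closure_of
    by (auto simp: norm_dist_def set_eq_iff)
qed

theorem proposition2p10:
  fixes N :: "'a::comm_ring_1 \<Rightarrow> real"
  assumes "comm_banach_ring N"
    and "\<And>a b. N (a * b) = N a * N b"
  shows "(second_countable (affine_line_topology N)
            \<longleftrightarrow> separable_space (Metric_space.mtopology UNIV (norm_dist N)))
       \<and> (separable_space (Metric_space.mtopology UNIV (norm_dist N))
            \<longleftrightarrow> (\<forall>n::nat. 0 < n \<longrightarrow> metrizable_space (spectrum_disc_topology N n)))"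
proof -
  let ?S = "separable_space (Metric_space.mtopology UNIV (norm_dist N))"
  note pt = point_evaluation_in_affine_line[OF assms]
  have S12: ?S if "second_countable (affine_line_topology N)"
  proof -
    have "range (point_evaluation N) \<subseteq> topspace (affine_line_topology N)"
      using pt by auto
    from second_countable_imp_countable_dense_subset[OF that this] show ?S
      unfolding separable_norm_iff[OF assms(1)]
      using dense_point_evaluations_imp_dense_points[OF assms, of _ UNIV] by auto
  qed
  have S2: "second_countable (affine_line_topology N) \<and> metrizable_space (affine_line_topology N)" if ?S
  proof -
    obtain D where "countable D" "\<And>a e. 0 < e \<Longrightarrow> \<exists>d\<in>D. N (a - d) < e"
      using \<open>?S\<close> unfolding separable_norm_iff[OF assms(1)] by blast
    then obtain T where "affine_line_topology N homeomorphic_space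
        subtopology (euclidean :: (nat \<Rightarrow> real) topology) T"
      using affine_line_embeds_into_countable_power by blast
    then show ?thesis
      using homeomorphic_space_second_countability homeomorphic_metrizable_space
        second_countable_subtopology[OF second_countable_euclidean]
        metrizable_space_subtopology[OF metrizable_space_euclidean] by blast
  qed
  have S32: ?S if metrizable: "\<And>n::nat. 0 < n \<Longrightarrow> metrizable_space (spectrum_disc_topology N n)"
  proof -
    have "\<exists>D. countable D \<and> (\<forall>a\<in>{a. N a \<le> real (Suc n)}. \<forall>e>0. \<exists>d\<in>D. N (a - d) < e)" for n
    proof -
      let ?X = "spectrum_disc_topology N (Suc n)"
      let ?B = "{a. N a \<le> real (Suc n)}"
      have "point_evaluation N ` ?B \<subseteq> topspace ?X"
        using pt by (auto simp: spectrum_disc_topology_def point_evaluation_def)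
      then obtain C where C: "countable C" "C \<subseteq> point_evaluation N ` ?B"
          "point_evaluation N ` ?B \<subseteq> ?X closure_of C"
        using compact_metrizable_imp_countable_dense_subset[OF compact_space_spectrum_disc metrizable]
        by (metis zero_less_Suc)
      moreover have "?X closure_of C \<subseteq> affine_line_topology N closure_of C"
        unfolding spectrum_disc_topology_def
        by (metis closure_of_mono closure_of_subtopology_subset subset_trans order_refl)
      ultimately show ?thesis
        by (intro dense_point_evaluations_imp_dense_points[OF assms]) auto
    qed
    then obtain D where D: "\<And>n. countable (D n)"
        "\<And>n a e. N a \<le> real (Suc n) \<Longrightarrow> 0 < e \<Longrightarrow> \<exists>d\<in>D n. N (a - d) < e"
      by (metis mem_Collect_eq)
    have "\<exists>d\<in>\<Union>n. D n. N (a - d) < e" if "0 < e" for a e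
    proof -
      obtain n where "N a \<le> real n" using real_arch_simple by blast
      then show ?thesis using D(2)[of a n e] \<open>0 < e\<close> by auto
    qed
    moreover have "countable (\<Union>n. D n)" using D(1) by simp
    ultimately show ?S unfolding separable_norm_iff[OF assms(1)] by blast
  qed
  show ?thesis
    using S12 S2 S32 metrizable_space_subtopology
    unfolding spectrum_disc_topology_def by blast
qed

end
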